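(* For every integer $m\ge 2$, $$\sum_{k=2}^m a_{mk}\, k = m.$$
   Context: For an integer $m\ge 2$ let $\psi_m(n) = n + (m-1)(n-1)B_{n-1,m-1}$, where $B_{a,b}=\frac{(a+b)!}{a!\,b!}$, for positive integers $n$; equivalently $\psi_m$ is the polynomial of degree $m$ in $n$ given by $\psi_m(n) = n + \frac{n-1}{(m-2)!}\prod_{j=0}^{m-2}(n+j)$. Its coefficients of $n^0$ and $n^1$ vanish. The rational numbers $a_{mk}$ ($2\le k\le m$) are defined by expanding in powers of $n$: $\psi_m(n)=\sum_{k=2}^m a_{mk}n^k$. *)

theory Defs
  imports Complex_Main "HOL-Computational_Algebra.Polynomial"
begin

definition B :: "nat \<Rightarrow> nat \<Rightarrow> rat" where
  "B a b = fact (a + b) / (fact a * fact b)"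

(* Meaningful for m \<ge> 2 and n \<ge> 1, so that the natural subtractions do not truncate. *)
definition psi :: "nat \<Rightarrow> nat \<Rightarrow> rat" where
  "psi m n = of_nat n + of_nat (m - 1) * of_nat (n - 1) * B (n - 1) (m - 1)"

(* The polynomial in the indeterminate n with
   psi_m(n) = n + (n - 1) / (m - 2)! * (\<Prod>j=0..m-2. n + j);  [:c, 1:] is n + c. *)
definition psi_poly :: "nat \<Rightarrow> rat poly" where
  "psi_poly m =
     [:0, 1:] + smult (1 / fact (m - 2)) ([:-1, 1:] * (\<Prod>j = 0..m - 2. [:of_nat j, 1:]))"

definition a :: "nat \<Rightarrow> nat \<Rightarrow> rat" where
  "a m k = coeff (psi_poly m) k"

lemma prod_shift_fact:
  "(\<Prod>j = 0..r. (of_nat (Suc n) + of_nat j :: rat)) = fact (n + r + 1) / fact n"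
proof (induction r)
  case 0
  then show ?case by (simp add: field_simps)
next
  case (Suc r)
  have "(\<Prod>j = 0..Suc r. (of_nat (Suc n) + of_nat j :: rat))
        = fact (n + r + 1) / fact n * (of_nat (Suc n) + of_nat (Suc r))"
    using Suc by simp
  also have "\<dots> = fact (n + Suc r + 1) / fact n"
    by (simp add: field_simps)
  finally show ?case .
qed

lemma poly_psi_poly:
  assumes "m \<ge> 2" "n \<ge> 1"
  shows "poly (psi_poly m) (of_nat n) = psi m n"
proof -
  obtain r where m: "m = r + 2" using assms(1) by (metis add.commute le_Suc_ex)
  obtain k where n: "n = Suc k" using assms(2) by (cases n) auto
  have "poly (psi_poly m) (of_nat n) =
        of_nat n + of_nat k / fact r * (\<Prod>j = 0..r. (of_nat (Suc k) + of_nat j :: rat))"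
    by (simp add: psi_poly_def m n poly_prod algebra_simps)
  also have "\<dots> = of_nat n + of_nat k / fact r * (fact (k + r + 1) / fact k)"
    by (simp only: prod_shift_fact)
  also have "\<dots> = psi m n"
  proof -
    have f: "(fact (Suc r) :: rat) = of_nat (Suc r) * fact r" by (rule fact_Suc)
    have nz: "(of_nat (Suc r) :: rat) \<noteq> 0" by (rule of_nat_neq_0)
    have "psi m n = of_nat n + of_nat (Suc r) * of_nat k *
            (fact (k + Suc r) / (fact k * (of_nat (Suc r) * fact r)))"
      by (simp only: psi_def B_def m n f[symmetric]) simp
    also have "\<dots> = of_nat n + of_nat k / fact r * (fact (k + r + 1) / fact k)"
      using nz by (simp del: of_nat_Suc fact_Suc add: divide_simps)
    finally show ?thesis by simp
  qed
  finally show ?thesis .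
qed

lemma degree_psi_poly:
  assumes "m \<ge> 2"
  shows "degree (psi_poly m) = m"
proof -
  let ?P = "\<Prod>j = 0..m - 2. [:of_nat j, 1 :: rat:]"
  have dP: "degree ?P = m - 1"
    using assms by (subst degree_prod_eq_sum_degree) auto
  have P0: "?P \<noteq> 0" by auto
  have "degree ([:-1, 1:] * ?P) = 1 + (m - 1)"
    by (subst degree_mult_eq) (use P0 dP in auto)
  then have "degree (smult (1 / fact (m - 2)) ([:-1, 1:] * ?P)) = m"
    using assms by simp
  then show ?thesis
    unfolding psi_poly_def by (subst degree_add_eq_right) (use assms in auto)
qed

lemma
  assumes "m \<ge> 2"
  shows a_0: "a m 0 = 0" and a_1: "a m 1 = 0"
proof -
  obtain r where m: "m = r + 2" using assms by (metis add.commute le_Suc_ex)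
  let ?Q = "\<Prod>j = 1..r. [:of_nat j, 1 :: rat:]"
  have "(\<Prod>j = 0..r. [:of_nat j, 1 :: rat:]) = [:0, 1:] * ?Q"
    by (subst prod.atLeast_Suc_atMost) auto
  then have e: "psi_poly m = [:0, 1:] + smult (1 / fact r) ([:-1, 1:] * ([:0, 1:] * ?Q))"
    by (simp add: psi_poly_def m)
  have "poly ?Q 0 = (\<Prod>j = 1..r. of_nat j)" by (simp add: poly_prod)
  then have c: "coeff ?Q 0 = fact r"
    by (simp add: poly_0_coeff_0 fact_prod)
  show "a m 0 = 0" by (simp add: a_def e)
  show "a m 1 = 0" using c by (simp add: a_def e)
qed

lemma psi_expansion:
  assumes "m \<ge> 2" "n \<ge> 1"
  shows "psi m n = (\<Sum>k = 2..m. a m k * of_nat n ^ k)"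
proof -
  have "psi m n = (\<Sum>k\<le>m. a m k * of_nat n ^ k)"
    using assms by (simp add: poly_psi_poly[symmetric] poly_altdef degree_psi_poly a_def)
  also have "\<dots> = (\<Sum>k = 2..m. a m k * of_nat n ^ k)"
  proof (rule sum.mono_neutral_right)
    show "\<forall>k\<in>{..m} - {2..m}. a m k * of_nat n ^ k = 0"
    proof
      fix k assume "k \<in> {..m} - {2..m}"
      then have "k = 0 \<or> k = 1" by auto
      then show "a m k * of_nat n ^ k = 0" using a_0[OF assms(1)] a_1[OF assms(1)] by auto
    qed
  qed auto
  finally show ?thesis .
qed

end

theory Submission imports Defs begin

text \<open>
  The sum of the numbers \<open>a m k * k\<close> over all \<open>k\<close> is the derivative of \<open>psi_poly m\<close> at \<open>1\<close>;
  starting the sum at \<open>k = 2\<close> loses nothing because the linear coefficient \<open>a m 1\<close> vanishes.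
  The derivative is immediate from the factored form of \<open>psi_poly m\<close>: the factor \<open>n - 1\<close> vanishes
  at \<open>1\<close>, so the product rule only leaves the other factor
  \<open>(\<Prod>j = 0..m - 2. 1 + j) / (m - 2)! = (m - 1)! / (m - 2)! = m - 1\<close>, to which the summand \<open>n\<close>
  contributes a further \<open>1\<close>.
\<close>

lemma poly_pderiv_1:
  fixes p :: "'a :: {comm_semiring_1, semiring_no_zero_divisors} poly"
  shows "poly (pderiv p) 1 = (\<Sum>k\<le>degree p. coeff p k * of_nat k)"
proof (induction p)
  case 0
  then show ?case by simp
next
  case (pCons c p)
  show ?case
  proof (cases "p = 0")
    case False
    have "poly (pderiv (pCons c p)) 1 = poly p 1 + poly (pderiv p) 1"
      by (simp add: pderiv_pCons)
    also have "\<dots> = (\<Sum>k\<le>degree p. coeff p k * of_nat (Suc k))"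
      unfolding pCons.IH by (simp add: poly_altdef sum.distrib algebra_simps)
    also have "\<dots> = (\<Sum>k\<le>degree (pCons c p). coeff (pCons c p) k * of_nat k)"
      using False by (simp add: sum.atMost_Suc_shift del: of_nat_Suc sum.atMost_Suc)
    finally show ?thesis .
  qed (simp add: pderiv_pCons)
qed

lemma poly_pderiv_psi_poly_1:
  assumes "m \<ge> 2"
  shows "poly (pderiv (psi_poly m)) 1 = of_nat m"
proof -
  obtain r where m: "m = r + 2" using assms by (metis add.commute le_Suc_ex)
  let ?P = "\<Prod>j = 0..r. [:of_nat j, 1 :: rat:]"
  have "poly ?P 1 = (\<Prod>j = 0..r. of_nat (Suc 0) + of_nat j)"
    by (simp add: poly_prod add.commute)
  also have "\<dots> = fact (Suc r)"
    by (subst prod_shift_fact) simp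
  finally have P1: "poly ?P 1 = fact (Suc r)" .
  have "poly (pderiv ([:-1, 1:] * ?P)) 1 = poly ?P 1"
    by (simp add: pderiv_mult pderiv_pCons del: mult_pCons_left)
  then have "poly (pderiv (psi_poly m)) 1 = 1 + fact (Suc r) / fact r"
    by (simp add: psi_poly_def m pderiv_add pderiv_smult pderiv_pCons P1
        del: fact_Suc mult_pCons_left)
  then show ?thesis by (simp add: m)
qed

theorem mainTheorem4:
  fixes m :: nat
  assumes "m \<ge> 2"
  shows "(\<Sum>k = 2..m. a m k * of_nat k) = of_nat m"
proof -
  have "(\<Sum>k = 2..m. a m k * of_nat k) = (\<Sum>k\<le>m. a m k * of_nat k)"
  proof (rule sum.mono_neutral_left)
    show "\<forall>k\<in>{..m} - {2..m}. a m k * of_nat k = 0"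
    proof
      fix k assume "k \<in> {..m} - {2..m}"
      then have "k = 0 \<or> k = 1" by auto
      then show "a m k * of_nat k = 0" using a_1[OF assms] by auto
    qed
  qed auto
  also have "\<dots> = poly (pderiv (psi_poly m)) 1"
    by (simp add: poly_pderiv_1 degree_psi_poly[OF assms] a_def)
  also have "\<dots> = of_nat m"
    by (rule poly_pderiv_psi_poly_1[OF assms])
  finally show ?thesis .
qed

end
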